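(* If $G$ is an undirected path, cycle, or complete graph, then $G$ admits a rigid orientation. Therefore $D_{\min}(G)=D'_{\min}(G)=1$, $\chi_{D,\min}(G)=\chi(G)$ and $\chi'_{D,\min}(G)=\chi'(G)$.
   Context: An orientation of a simple graph assigns one direction to each edge. An automorphism of an oriented graph is a permutation $\phi$ of its vertices such that $\phi(u)\phi(v)$ is an arc whenever $uv$ is an arc; an oriented graph is rigid if its only automorphism is the identity. An $r$-vertex-labelling maps vertices to $\{1,\dots,r\}$, an $r$-arc-labelling maps arcs to $\{1,\dots,r\}$; colourings are proper labellings (adjacent vertices, resp. arcs sharing an end-vertex, get distinct labels). A labelling $\lambda$ is distinguishing if the only automorphism $\phi$ with $\lambda(\phi(u))=\lambda(u)$ for all vertices (resp. $\lambda(\phi(u)\phi(v))=\lambda(uv)$ for all arcs) is the identity. For an oriented graph $\vec G$, $D(\vec G)$, $\chi_D(\vec G)$, $D'(\vec G)$, $\chi'_D(\vec G)$ are the least $r$ for which $\vec G$ admits a distinguishing $r$-vertex-labelling, $r$-vertex-colouring, $r$-arc-labelling, $r$-arc-colouring. For an undirected graph $G$, $D_{\min}(G)$, $\chi_{D,\min}(G)$, $D'_{\min}(G)$, $\chi'_{D,\min}(G)$ are the minima of these respective parameters over all orientations of $G$. $\chi(G)$, $\chi'(G)$ are the chromatic number and chromatic index. *)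

theory Defs
  imports
    "Graph_Theory.Kuratowski"
    "HOL-Combinatorics.Permutations"
    "HOL-Library.Extended_Nat"
begin

(* A finite simple undirected graph is a pair_graph (finite, loopless, symmetric arc relation);
   its edges are the unordered pairs underlying the arcs. Oriented graphs live in the same record
   type, with an antisymmetric arc relation. *)

definition edges :: "'a pair_pre_digraph \<Rightarrow> 'a set set" where
  "edges G = {{u, v} | u v. (u, v) \<in> parcs G}"

definition path_graph :: "'a pair_pre_digraph \<Rightarrow> bool" where
  "path_graph G \<longleftrightarrow> pair_graph G \<and>
     (\<exists>xs. xs \<noteq> [] \<and> distinct xs \<and> pverts G = set xs \<and>
           edges G = {{xs ! i, xs ! Suc i} | i. Suc i < length xs})"

definition cycle_graph :: "'a pair_pre_digraph \<Rightarrow> bool" where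
  "cycle_graph G \<longleftrightarrow> pair_graph G \<and>
     (\<exists>xs. length xs \<ge> 3 \<and> distinct xs \<and> pverts G = set xs \<and>
           edges G = {{xs ! i, xs ! (Suc i mod length xs)} | i. i < length xs})"

definition complete_graph :: "'a pair_pre_digraph \<Rightarrow> bool" where
  "complete_graph G \<longleftrightarrow> (\<exists>n\<ge>1. complete_digraph n (with_proj G))"

definition orientation_of :: "'a pair_pre_digraph \<Rightarrow> 'a pair_pre_digraph \<Rightarrow> bool" where
  "orientation_of H G \<longleftrightarrow> pverts H = pverts G \<and> parcs H \<subseteq> parcs G \<and>
     (\<forall>(u, v)\<in>parcs G. ((u, v) \<in> parcs H) \<noteq> ((v, u) \<in> parcs H))"

(* With "permutes", maps are the identity outside the vertex set, so the identity automorphism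
   is exactly the function id. *)

definition automorphism :: "'a pair_pre_digraph \<Rightarrow> ('a \<Rightarrow> 'a) \<Rightarrow> bool" where
  "automorphism H \<phi> \<longleftrightarrow> \<phi> permutes pverts H \<and> (\<forall>(u, v)\<in>parcs H. (\<phi> u, \<phi> v) \<in> parcs H)"

definition rigid :: "'a pair_pre_digraph \<Rightarrow> bool" where
  "rigid H \<longleftrightarrow> (\<forall>\<phi>. automorphism H \<phi> \<longrightarrow> \<phi> = id)"

definition distinguishing_vertices :: "'a pair_pre_digraph \<Rightarrow> ('a \<Rightarrow> nat) \<Rightarrow> bool" where
  "distinguishing_vertices H l \<longleftrightarrow>
     (\<forall>\<phi>. automorphism H \<phi> \<and> (\<forall>u\<in>pverts H. l (\<phi> u) = l u) \<longrightarrow> \<phi> = id)"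

definition distinguishing_arcs :: "'a pair_pre_digraph \<Rightarrow> ('a \<times> 'a \<Rightarrow> nat) \<Rightarrow> bool" where
  "distinguishing_arcs H l \<longleftrightarrow>
     (\<forall>\<phi>. automorphism H \<phi> \<and> (\<forall>(u, v)\<in>parcs H. l (\<phi> u, \<phi> v) = l (u, v)) \<longrightarrow> \<phi> = id)"

definition proper_vertices :: "'a pair_pre_digraph \<Rightarrow> ('a \<Rightarrow> nat) \<Rightarrow> bool" where
  "proper_vertices H l \<longleftrightarrow> (\<forall>(u, v)\<in>parcs H. l u \<noteq> l v)"

definition proper_arcs :: "'a pair_pre_digraph \<Rightarrow> ('a \<times> 'a \<Rightarrow> nat) \<Rightarrow> bool" where
  "proper_arcs H l \<longleftrightarrow>
     (\<forall>a\<in>parcs H. \<forall>b\<in>parcs H. a \<noteq> b \<and> {fst a, snd a} \<inter> {fst b, snd b} \<noteq> {} \<longrightarrow> l a \<noteq> l b)"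

definition proper_edges :: "'a pair_pre_digraph \<Rightarrow> ('a set \<Rightarrow> nat) \<Rightarrow> bool" where
  "proper_edges G l \<longleftrightarrow> (\<forall>e\<in>edges G. \<forall>f\<in>edges G. e \<noteq> f \<and> e \<inter> f \<noteq> {} \<longrightarrow> l e \<noteq> l f)"

(* The number of labels is a positive integer; this matters only for edge and arc parameters of
   edgeless graphs and for the null graph, where the value is 1 instead of 0. The value is infinite
   if no suitable r exists (e.g. an oriented graph with two isolated vertices has no distinguishing
   arc-labelling). *)

definition least_labels :: "(nat \<Rightarrow> bool) \<Rightarrow> enat" where
  "least_labels P = (INF r\<in>{r. 1 \<le> r \<and> P r}. enat r)"

definition dist_number :: "'a pair_pre_digraph \<Rightarrow> enat" where
  "dist_number H =
     least_labels (\<lambda>r. \<exists>l. l \<in> pverts H \<rightarrow> {1..r} \<and> distinguishing_vertices H l)"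

definition dist_chromatic_number :: "'a pair_pre_digraph \<Rightarrow> enat" where
  "dist_chromatic_number H =
     least_labels (\<lambda>r. \<exists>l. l \<in> pverts H \<rightarrow> {1..r} \<and> proper_vertices H l \<and> distinguishing_vertices H l)"

definition dist_index :: "'a pair_pre_digraph \<Rightarrow> enat" where
  "dist_index H =
     least_labels (\<lambda>r. \<exists>l. l \<in> parcs H \<rightarrow> {1..r} \<and> distinguishing_arcs H l)"

definition dist_chromatic_index :: "'a pair_pre_digraph \<Rightarrow> enat" where
  "dist_chromatic_index H =
     least_labels (\<lambda>r. \<exists>l. l \<in> parcs H \<rightarrow> {1..r} \<and> proper_arcs H l \<and> distinguishing_arcs H l)"

definition chromatic_number :: "'a pair_pre_digraph \<Rightarrow> enat" where
  "chromatic_number G =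
     least_labels (\<lambda>r. \<exists>l. l \<in> pverts G \<rightarrow> {1..r} \<and> proper_vertices G l)"

definition chromatic_index :: "'a pair_pre_digraph \<Rightarrow> enat" where
  "chromatic_index G =
     least_labels (\<lambda>r. \<exists>l. l \<in> edges G \<rightarrow> {1..r} \<and> proper_edges G l)"

definition min_over_orientations ::
  "('a pair_pre_digraph \<Rightarrow> enat) \<Rightarrow> 'a pair_pre_digraph \<Rightarrow> enat" where
  "min_over_orientations p G = (INF H\<in>{H. orientation_of H G}. p H)"

end

theory Submission
  imports Defs
begin

text \<open>The graphs in question all have a Hamiltonian path \<open>e 0, \<dots>, e (n - 1)\<close>. Directing every edge
  from the smaller to the larger index yields a rigid orientation: an automorphism maps the directed
  Hamiltonian path to a directed path, so it acts on the indices as a strictly increasing self-map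
  of \<open>{..<n}\<close>. For a rigid orientation every labelling is distinguishing, and properness does not
  depend on the orientation.\<close>

text \<open>Over \<open>k\<close> steps, \<open>f\<close> gains at least \<open>k\<close>. Climbing
  from 0 gives \<open>i \<le> f i\<close>. Climbing from \<open>i\<close> to the top index
  \<open>n - 1\<close>, where \<open>f\<close> is still below \<open>n\<close>, leaves no room for
  \<open>f i > i\<close>.\<close>

lemma strict_increasing_self_map_eq:
  fixes f :: "nat \<Rightarrow> nat"
  assumes step: "\<And>i. Suc i < n \<Longrightarrow> f i < f (Suc i)"
    and bound: "\<And>i. i < n \<Longrightarrow> f i < n" and "i < n"
  shows "f i = i"
proof -
  have grow: "i + k < n \<Longrightarrow> f i + k \<le> f (i + k)" for i k
  proof (induction k)
    case (Suc k)
    with step[of "i + k"] show ?case by simp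
  qed simp
  have "i \<le> f i" using grow[of 0 i] \<open>i < n\<close> by simp
  moreover have "f i \<le> i"
    using grow[of i "n - 1 - i"] bound[of "n - 1"] \<open>i < n\<close> by simp
  ultimately show ?thesis by simp
qed

lemma rigid_orientation_if_hamiltonian_path:
  fixes e :: "nat \<Rightarrow> 'a"
  assumes "sym (parcs G)" "irrefl (parcs G)" "parcs G \<subseteq> pverts G \<times> pverts G"
    and e: "bij_betw e {..<n} (pverts G)"
    and arc: "\<And>i. Suc i < n \<Longrightarrow> (e i, e (Suc i)) \<in> parcs G"
  obtains H where "orientation_of H G" "rigid H"
proof -
  \<comment> \<open>The position of a vertex on the Hamiltonian path; arcs of \<open>H\<close> will
    be those along which it increases.\<close>
  define p where "p = inv_into {..<n} e"
  have p: "bij_betw p (pverts G) {..<n}"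
    unfolding p_def by (rule bij_betw_inv_into[OF e])
  have pe: "p (e i) = i" if "i < n" for i
    unfolding p_def using bij_betw_inv_into_left[OF e] that by simp
  have ep: "e (p v) = v" if "v \<in> pverts G" for v
    unfolding p_def using bij_betw_inv_into_right[OF e] that by simp
  have pn: "p v < n" if "v \<in> pverts G" for v
    using bij_betwE[OF p] that by auto
  have eG: "e i \<in> pverts G" if "i < n" for i
    using bij_betwE[OF e] that by auto
  define H where "H = \<lparr>pverts = pverts G, parcs = {(u, v) \<in> parcs G. p u < p v}\<rparr>"
  have "orientation_of H G"
    unfolding orientation_of_def
  proof (intro conjI ballI)
    fix a assume a: "a \<in> parcs G"
    obtain u v where uv: "a = (u, v)" by fastforce
    have "(v, u) \<in> parcs G" using assms(1) a uv by (auto dest: symD)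
    moreover have "u \<noteq> v" using assms(2) a uv by (auto simp: irrefl_def)
    \<comment> \<open>No edge joins vertices in equal position, so exactly one of its two directions
      is increasing.\<close>
    then have "p u \<noteq> p v" using ep assms(3) a uv by (metis mem_Sigma_iff subsetD)
    ultimately show "case a of (u, v) \<Rightarrow> ((u, v) \<in> parcs H) \<noteq> ((v, u) \<in> parcs H)"
      using a uv by (auto simp: H_def)
  qed (auto simp: H_def)
  moreover have "rigid H"
    unfolding rigid_def
  proof (intro allI impI)
    fix \<phi> assume "automorphism H \<phi>"
    then have perm: "\<phi> permutes pverts G"
      and hom: "\<And>u v. (u, v) \<in> parcs H \<Longrightarrow> (\<phi> u, \<phi> v) \<in> parcs H"
      by (auto simp: automorphism_def H_def)
    \<comment> \<open>Only the arcs between consecutive path vertices matter here: their images are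
      arcs of \<open>H\<close>, hence raise the position strictly.\<close>
    have "p (\<phi> (e i)) = i" if "i < n" for i
    proof (rule strict_increasing_self_map_eq[OF _ _ that])
      show "p (\<phi> (e i)) < p (\<phi> (e (Suc i)))" if "Suc i < n" for i
        using hom[of "e i" "e (Suc i)"] arc[OF that] pe that by (auto simp: H_def)
      show "p (\<phi> (e i)) < n" if "i < n" for i
        using pn eG[OF that] permutes_in_image[OF perm] by auto
    qed
    then have "\<phi> v = v" if "v \<in> pverts G" for v
      using ep pn permutes_in_image[OF perm] that by metis
    then show "\<phi> = id"
      using permutes_not_in[OF perm] by fastforce
  qed
  ultimately show ?thesis using that by blast
qed

lemma least_labels_antimono:
  assumes "\<And>r. P r \<Longrightarrow> Q r"
  shows "least_labels Q \<le> least_labels P"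
  unfolding least_labels_def by (rule INF_superset_mono) (use assms in auto)

text \<open>This also covers the case that no \<open>r\<close> qualifies, since the infimum of the
  empty set is infinite.\<close>

lemma one_le_least_labels: "1 \<le> least_labels P"
  unfolding least_labels_def by (rule INF_greatest) (simp add: one_enat_def)

lemma least_labels_eq_1:
  assumes "P 1"
  shows "least_labels P = 1"
proof (rule antisym[OF _ one_le_least_labels])
  show "least_labels P \<le> 1"
    unfolding least_labels_def one_enat_def by (rule INF_lower) (use assms in simp)
qed

text \<open>The witness \<open>H\<close> needs only the upper bound, as the uniform lower bound
  applies to it too.\<close>

lemma min_over_orientations_eqI:
  assumes "orientation_of H G" "p H \<le> c" "\<And>K. orientation_of K G \<Longrightarrow> c \<le> p K"
  shows "min_over_orientations p G = c"
  unfolding min_over_orientations_def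
proof (rule antisym)
  show "(INF H\<in>{H. orientation_of H G}. p H) \<le> c"
    using assms(1,2) by (auto intro: INF_lower2)
  show "c \<le> (INF H\<in>{H. orientation_of H G}. p H)"
    using assms(3) by (auto intro: INF_greatest)
qed

lemma rigid_distinguishing:
  assumes "rigid H"
  shows "distinguishing_vertices H l" "distinguishing_arcs H m"
  using assms by (auto simp: rigid_def distinguishing_vertices_def distinguishing_arcs_def)

text \<open>The condition \<open>l u \<noteq> l v\<close> is symmetric, and \<open>H\<close> keeps
  each edge of \<open>G\<close> in one direction.\<close>

lemma proper_vertices_orientation:
  assumes "orientation_of H G" "sym (parcs G)"
  shows "proper_vertices H l \<longleftrightarrow> proper_vertices G l"
  using assms unfolding proper_vertices_def orientation_of_def sym_def by fastforce

text \<open>Of the two arcs over an edge, at most one lies in \<open>H\<close>, which gives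
  injectivity, and at least one does, which gives surjectivity.\<close>

lemma orientation_edges_bij:
  assumes H: "orientation_of H G" and "sym (parcs G)"
  shows "bij_betw (\<lambda>a. {fst a, snd a}) (parcs H) (edges G)"
  unfolding bij_betw_def
proof
  have asym: "(v, u) \<notin> parcs H" if "(u, v) \<in> parcs H" for u v
    using H that unfolding orientation_of_def by blast
  show "inj_on (\<lambda>a. {fst a, snd a}) (parcs H)"
    by (rule inj_onI) (auto simp: doubleton_eq_iff dest: asym)
  show "(\<lambda>a. {fst a, snd a}) ` parcs H = edges G"
  proof
    show "(\<lambda>a. {fst a, snd a}) ` parcs H \<subseteq> edges G"
      using H by (fastforce simp: orientation_of_def edges_def)
    show "edges G \<subseteq> (\<lambda>a. {fst a, snd a}) ` parcs H"
    proof
      fix x assume "x \<in> edges G"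
      then obtain u v where "x = {u, v}" "(u, v) \<in> parcs G" by (auto simp: edges_def)
      moreover from this have "(u, v) \<in> parcs H \<or> (v, u) \<in> parcs H"
        using H by (auto simp: orientation_of_def)
      ultimately show "x \<in> (\<lambda>a. {fst a, snd a}) ` parcs H"
        by (auto simp: image_iff insert_commute intro: bexI[of _ "(u, v)"] bexI[of _ "(v, u)"])
    qed
  qed
qed

text \<open>Labellings are transported along the bijection between arcs and edges: two arcs share an
  end-vertex iff the corresponding edges intersect.\<close>

lemma ex_proper_arcs_iff_ex_proper_edges:
  assumes "orientation_of H G" "sym (parcs G)"
  shows "(\<exists>l. l \<in> parcs H \<rightarrow> R \<and> proper_arcs H l) \<longleftrightarrow> (\<exists>l. l \<in> edges G \<rightarrow> R \<and> proper_edges G l)"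
    (is "?A \<longleftrightarrow> ?E")
proof -
  define b where "b = (\<lambda>a :: 'a \<times> 'a. {fst a, snd a})"
  have bij: "bij_betw b (parcs H) (edges G)"
    unfolding b_def using assms by (rule orientation_edges_bij)
  then have inj: "inj_on b (parcs H)" and img: "edges G = b ` parcs H"
    by (auto simp: bij_betw_def)
  have proper: "proper_arcs H (m \<circ> b) \<longleftrightarrow> proper_edges G m" for m
    unfolding proper_arcs_def proper_edges_def img using inj_on_eq_iff[OF inj]
    by (simp add: b_def)
  show ?thesis
  proof
    assume ?A
    then obtain l where l: "l \<in> parcs H \<rightarrow> R" "proper_arcs H l" by blast
    \<comment> \<open>Each edge inherits the label of its unique arc. Then
      \<open>m \<circ> b\<close> agrees with \<open>l\<close> on \<open>parcs H\<close>, and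
      properness looks at no other values.\<close>
    define m where "m = l \<circ> inv_into (parcs H) b"
    have m: "(m \<circ> b) a = l a" if "a \<in> parcs H" for a
      using that inj by (simp add: m_def)
    have "proper_arcs H (m \<circ> b)"
      using l(2) m unfolding proper_arcs_def by metis
    moreover have "m \<in> edges G \<rightarrow> R"
      using l(1) m by (auto simp: img)
    ultimately show ?E using proper by blast
  next
    assume ?E
    then obtain m where "m \<in> edges G \<rightarrow> R" "proper_edges G m" by blast
    then have "m \<circ> b \<in> parcs H \<rightarrow> R" "proper_arcs H (m \<circ> b)"
      using proper by (auto simp: img)
    then show ?A by blast
  qed
qed

text \<open>Upper bounds are attained at \<open>H\<close>, where being distinguishing costs nothing.
  The lower bounds for an arbitrary orientation come from the label count being positive or from
  forgetting that a proper labelling is distinguishing.\<close>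

lemma rigid_orientation_parameters:
  assumes H: "orientation_of H G" and rigid: "rigid H" and sym: "sym (parcs G)"
  shows "min_over_orientations dist_number G = 1"
    and "min_over_orientations dist_index G = 1"
    and "min_over_orientations dist_chromatic_number G = chromatic_number G"
    and "min_over_orientations dist_chromatic_index G = chromatic_index G"
proof -
  note dist = rigid_distinguishing[OF rigid]
  show "min_over_orientations dist_number G = 1"
  proof (rule min_over_orientations_eqI[OF H])
    have "dist_number H = 1"
      unfolding dist_number_def using dist by (intro least_labels_eq_1 exI[of _ "\<lambda>_. 1"]) auto
    then show "dist_number H \<le> 1" by simp
  qed (simp add: dist_number_def one_le_least_labels)
  show "min_over_orientations dist_index G = 1"
  proof (rule min_over_orientations_eqI[OF H])
    have "dist_index H = 1"
      unfolding dist_index_def using dist by (intro least_labels_eq_1 exI[of _ "\<lambda>_. 1"]) auto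
    then show "dist_index H \<le> 1" by simp
  qed (simp add: dist_index_def one_le_least_labels)
  show "min_over_orientations dist_chromatic_number G = chromatic_number G"
  proof (rule min_over_orientations_eqI[OF H])
    show "dist_chromatic_number H \<le> chromatic_number G"
      unfolding dist_chromatic_number_def chromatic_number_def
      using H dist proper_vertices_orientation[OF H sym]
      by (intro least_labels_antimono) (auto simp: orientation_of_def)
    show "chromatic_number G \<le> dist_chromatic_number K" if K: "orientation_of K G" for K
      unfolding dist_chromatic_number_def chromatic_number_def
      using K proper_vertices_orientation[OF K sym]
      by (intro least_labels_antimono) (auto simp: orientation_of_def)
  qed
  show "min_over_orientations dist_chromatic_index G = chromatic_index G"
  proof (rule min_over_orientations_eqI[OF H])
    show "dist_chromatic_index H \<le> chromatic_index G"
      unfolding dist_chromatic_index_def chromatic_index_def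
      using dist ex_proper_arcs_iff_ex_proper_edges[OF H sym]
      by (intro least_labels_antimono) auto
    show "chromatic_index G \<le> dist_chromatic_index K" if K: "orientation_of K G" for K
      unfolding dist_chromatic_index_def chromatic_index_def
      using ex_proper_arcs_iff_ex_proper_edges[OF K sym]
      by (intro least_labels_antimono) blast
  qed
qed

text \<open>The edge \<open>{u, v}\<close> may stem from the arc \<open>(v, u)\<close>; symmetry
  then supplies \<open>(u, v)\<close>.\<close>

lemma edges_iff_parcs:
  assumes "sym (parcs G)"
  shows "{u, v} \<in> edges G \<longleftrightarrow> (u, v) \<in> parcs G"
  using assms by (auto simp: edges_def doubleton_eq_iff dest: symD)

lemma pair_graph_relation:
  assumes "pair_graph G"
  shows "sym (parcs G)" "irrefl (parcs G)" "parcs G \<subseteq> pverts G \<times> pverts G"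
proof -
  interpret pair_graph G by fact
  show "sym (parcs G)" using arcs_symmetric by (auto intro: symI)
  show "irrefl (parcs G)" using no_loops' by (auto simp: irrefl_def)
  show "parcs G \<subseteq> pverts G \<times> pverts G" using in_arcsD1 in_arcsD2 by auto
qed

theorem theorem5:
  fixes G :: "'a pair_pre_digraph"
  assumes "path_graph G \<or> cycle_graph G \<or> complete_graph G"
  shows "(\<exists>H. orientation_of H G \<and> rigid H) \<and>
         min_over_orientations dist_number G = 1 \<and>
         min_over_orientations dist_index G = 1 \<and>
         min_over_orientations dist_chromatic_number G = chromatic_number G \<and>
         min_over_orientations dist_chromatic_index G = chromatic_index G"
proof -
  \<comment> \<open>All three classes enter the rest of the argument only through such an
    enumeration \<open>e\<close> of the vertices.\<close>
  have "\<exists>(e :: nat \<Rightarrow> 'a) n. sym (parcs G) \<and> irrefl (parcs G) \<and> parcs G \<subseteq> pverts G \<times> pverts G \<and>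
      bij_betw e {..<n} (pverts G) \<and> (\<forall>i. Suc i < n \<longrightarrow> (e i, e (Suc i)) \<in> parcs G)"
    using assms
  proof (elim disjE)
    assume "path_graph G"
    then obtain xs where G: "pair_graph G" and xs: "distinct xs" "pverts G = set xs"
      and E: "edges G = {{xs ! i, xs ! Suc i} | i. Suc i < length xs}"
      by (auto simp: path_graph_def)
    note rel = pair_graph_relation[OF G]
    have "(xs ! i, xs ! Suc i) \<in> parcs G" if "Suc i < length xs" for i
      using that E edges_iff_parcs[OF rel(1)] by blast
    then show ?thesis
      using rel bij_betw_nth[OF xs(1) refl xs(2)] by blast
  next
    assume "cycle_graph G"
    then obtain xs where G: "pair_graph G" and xs: "distinct xs" "pverts G = set xs"
      and E: "edges G = {{xs ! i, xs ! (Suc i mod length xs)} | i. i < length xs}"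
      by (auto simp: cycle_graph_def)
    note rel = pair_graph_relation[OF G]
    \<comment> \<open>The edge closing the cycle is left out of the path; for all other indices the
      reduction modulo \<open>length xs\<close> has no effect.\<close>
    have "(xs ! i, xs ! Suc i) \<in> parcs G" if "Suc i < length xs" for i
    proof -
      have "{xs ! i, xs ! (Suc i mod length xs)} \<in> edges G"
        using that unfolding E by (auto intro!: exI[of _ i])
      then show ?thesis
        using that edges_iff_parcs[OF rel(1)] by simp
    qed
    then show ?thesis
      using rel bij_betw_nth[OF xs(1) refl xs(2)] by blast
  next
    assume "complete_graph G"
    then obtain n where n: "complete_digraph n (with_proj G)"
      by (auto simp: complete_graph_def)
    then have G: "pair_graph G"
      by (simp add: complete_digraph_def pair_graphI_graph)
    have fin: "finite (pverts G)" "card (pverts G) = n"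
      and arcs: "parcs G = {(u, v). (u, v) \<in> pverts G \<times> pverts G \<and> u \<noteq> v}"
      using n by (auto simp: complete_digraph_pair_def)
    obtain e :: "nat \<Rightarrow> 'a" where e: "bij_betw e {..<n} (pverts G)"
      using ex_bij_betw_nat_finite[OF fin(1)] fin(2) by (auto simp: atLeast0LessThan)
    \<comment> \<open>Any enumeration serves in a complete graph, because injectivity makes
      consecutive vertices distinct and hence adjacent.\<close>
    have "(e i, e (Suc i)) \<in> parcs G" if "Suc i < n" for i
      using that bij_betwE[OF e] bij_betw_imp_inj_on[OF e] by (auto simp: arcs inj_on_eq_iff)
    then show ?thesis using pair_graph_relation[OF G] e by blast
  qed
  then obtain e :: "nat \<Rightarrow> 'a" and n where sym: "sym (parcs G)"
    and path: "irrefl (parcs G)" "parcs G \<subseteq> pverts G \<times> pverts G" "bij_betw e {..<n} (pverts G)"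
      "\<And>i. Suc i < n \<Longrightarrow> (e i, e (Suc i)) \<in> parcs G"
    by blast
  obtain H where "orientation_of H G" "rigid H"
    using rigid_orientation_if_hamiltonian_path[OF sym path] by blast
  then show ?thesis
    using rigid_orientation_parameters sym by blast
qed

end
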